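(* Let $m\geq 2$. The adjacency algebra of the folded halved $2m$-cube contains a complex Hadamard matrix if and only if $m$ is even.
   Context: The halved $2m$-cube has as vertices the binary words of length $2m$ of even weight, adjacent when they differ in exactly two coordinates; it is antipodal with antipodal classes $\{a,a\oplus\mathbf{1}\}$. The folded halved $2m$-cube is the quotient graph obtained by identifying each $a$ with $a\oplus\mathbf{1}$ (two classes adjacent when some representatives are adjacent in the halved $2m$-cube); it is a distance-regular graph on $2^{2m-2}$ vertices with diameter $\lfloor m/2\rfloor$. The adjacency algebra of a graph is the complex algebra spanned by the powers of its adjacency matrix. A $v\times v$ matrix $W$ with nonzero entries is type II if $\sum_{c=1}^v W_{ac}/W_{bc}$ equals $v$ when $a=b$ and $0$ otherwise; a complex Hadamard matrix is a type II matrix all of whose entries have absolute value $1$. *)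

theory Defs
  imports "Jordan_Normal_Form.VS_Connect"
begin

definition halved_cube_verts :: "nat \<Rightarrow> bool list set" where
  "halved_cube_verts n = {a. length a = n \<and> even (count_list a True)}"

definition halved_cube_adj :: "bool list \<Rightarrow> bool list \<Rightarrow> bool" where
  "halved_cube_adj a b \<longleftrightarrow>
     length a = length b \<and> card {i. i < length a \<and> a ! i \<noteq> b ! i} = 2"

text \<open>\<open>map Not a\<close> is the word \<open>a \<oplus> \<one>\<close>.\<close>

definition antipodal_class :: "bool list \<Rightarrow> bool list set" where
  "antipodal_class a = {a, map Not a}"

definition folded_halved_cube_verts :: "nat \<Rightarrow> bool list set set" where
  "folded_halved_cube_verts m = antipodal_class ` halved_cube_verts (2 * m)"

text \<open>For \<open>m \<ge> 2\<close> this relation has no loops, since then \<open>a\<close> and \<open>map Not a\<close>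
  differ in \<open>2 * m > 2\<close> coordinates.\<close>

definition folded_halved_cube_adj :: "bool list set \<Rightarrow> bool list set \<Rightarrow> bool" where
  "folded_halved_cube_adj X Y \<longleftrightarrow> (\<exists>a\<in>X. \<exists>b\<in>Y. halved_cube_adj a b)"

text \<open>Matrices have rows and columns indexed by \<open>0, 1, \<dots>\<close>, so the adjacency matrix is taken
  with respect to a duplicate-free list \<open>vs\<close> of all vertices.\<close>

definition adjacency_matrix :: "'v list \<Rightarrow> ('v \<Rightarrow> 'v \<Rightarrow> bool) \<Rightarrow> complex mat" where
  "adjacency_matrix vs adj =
     mat (length vs) (length vs) (\<lambda>(i, j). if adj (vs ! i) (vs ! j) then 1 else 0)"

text \<open>The complex span of \<open>I, A, A\<^sup>2, \<dots>\<close> inside the space of square matrices of the order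
  of \<open>A\<close>.\<close>

definition adjacency_algebra :: "'v list \<Rightarrow> ('v \<Rightarrow> 'v \<Rightarrow> bool) \<Rightarrow> complex mat set" where
  "adjacency_algebra vs adj =
     LinearCombinations.module.span class_ring
       (module_mat TYPE(complex) (length vs) (length vs))
       {adjacency_matrix vs adj ^\<^sub>m k | k. True}"

definition type_II :: "complex mat \<Rightarrow> bool" where
  "type_II W \<longleftrightarrow> square_mat W \<and>
     (\<forall>a<dim_row W. \<forall>b<dim_row W. W $$ (a, b) \<noteq> 0) \<and>
     (\<forall>a<dim_row W. \<forall>b<dim_row W.
        (\<Sum>c<dim_row W. W $$ (a, c) / W $$ (b, c)) = (if a = b then of_nat (dim_row W) else 0))"

definition complex_Hadamard :: "complex mat \<Rightarrow> bool" where
  "complex_Hadamard W \<longleftrightarrow> type_II W \<and>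
     (\<forall>a<dim_row W. \<forall>b<dim_row W. cmod (W $$ (a, b)) = 1)"

lemma finite_folded_halved_cube_verts: "finite (folded_halved_cube_verts m)"
proof -
  have "halved_cube_verts (2 * m) \<subseteq> {a. set a \<subseteq> UNIV \<and> length a = 2 * m}"
    by (auto simp: halved_cube_verts_def)
  then have "finite (halved_cube_verts (2 * m))"
    by (rule finite_subset) (rule finite_lists_length_eq, simp)
  then show ?thesis
    by (simp add: folded_halved_cube_verts_def)
qed

lemma ex_enumeration_folded_halved_cube_verts:
  "\<exists>vs. distinct vs \<and> set vs = folded_halved_cube_verts m"
  using finite_distinct_list[OF finite_folded_halved_cube_verts] by blast

end

theory Submission
  imports Defs
begin

text \<open>
  An even word of length \<open>2 * m\<close> is identified with its support, a subset of \<open>{..<2 * m}\<close> of even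
  cardinality. Multiplication by the adjacency matrix acts on functions of the Hamming distance by
  the usual three-term recurrence, so the adjacency algebra consists exactly of the matrices
  \<open>g (hdist a b)\<close> with \<open>g (2 * m - w) = g w\<close>.

  For even \<open>m\<close>, half the weight modulo 2 is a nondegenerate quadratic form on the even words
  modulo the all-ones word, so \<open>(- 1) ^ (hdist a b div 2)\<close> is a real Hadamard matrix.

  A Hadamard matrix in the algebra is a multiple of a unitary matrix, so all its eigenvalues have
  absolute value \<open>2 ^ (m - 1)\<close>. For odd \<open>m\<close> the word of weight \<open>N = m - 1\<close> is even, and twice the
  eigenvalue at its character is a combination of the values of \<open>g\<close> whose coefficients are those
  of \<open>(1 - y) ^ N * (1 + y)\<close>. These cancel partially, so their absolute values sum to less than
  \<open>2 ^ m\<close>.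
\<close>

section \<open>The adjacency algebra as a linear span of matrices\<close>

lemma submodule_matI:
  fixes N :: "'a::field mat set"
  assumes "N \<subseteq> carrier_mat r c" and "0\<^sub>m r c \<in> N"
    and "\<And>X Y. X \<in> N \<Longrightarrow> Y \<in> N \<Longrightarrow> X + Y \<in> N"
    and "\<And>a X. X \<in> N \<Longrightarrow> a \<cdot>\<^sub>m X \<in> N"
  shows "submodule class_ring N (module_mat TYPE('a) r c)"
proof -
  interpret vectorspace class_ring "module_mat TYPE('a) r c" by (rule matrix_vs)
  show ?thesis
    using assms by unfold_locales (auto simp: module_mat_simps)
qed

context
  fixes vs :: "'v list" and adj :: "'v \<Rightarrow> 'v \<Rightarrow> bool"
begin

abbreviation (input) "adjmat \<equiv> adjacency_matrix vs adj"
abbreviation (input) "adjalg \<equiv> adjacency_algebra vs adj"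

lemma adjacency_matrix_carrier: "adjmat \<in> carrier_mat (length vs) (length vs)"
  by (simp add: adjacency_matrix_def)

lemma submodule_adjacency_algebra:
  "submodule class_ring adjalg (module_mat TYPE(complex) (length vs) (length vs))"
proof -
  interpret vectorspace class_ring "module_mat TYPE(complex) (length vs) (length vs)"
    by (rule matrix_vs)
  show ?thesis
    unfolding adjacency_algebra_def
    by (rule span_is_submodule)
      (auto simp: module_mat_simps intro!: pow_carrier_mat adjacency_matrix_carrier)
qed

lemma adjacency_algebra_zero: "0\<^sub>m (length vs) (length vs) \<in> adjalg"
  using submodule.zero_closed[OF submodule_adjacency_algebra] by (simp add: module_mat_simps)

lemma adjacency_algebra_add: "X \<in> adjalg \<Longrightarrow> Y \<in> adjalg \<Longrightarrow> X + Y \<in> adjalg"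
  using submodule.m_closed[OF submodule_adjacency_algebra, of X Y]
  by (simp add: module_mat_simps)

lemma adjacency_algebra_smult: "X \<in> adjalg \<Longrightarrow> c \<cdot>\<^sub>m X \<in> adjalg"
  using submodule.smult_closed[OF submodule_adjacency_algebra, of c X]
  by (simp add: module_mat_simps)

lemma adjacency_algebra_pow: "adjmat ^\<^sub>m k \<in> adjalg"
proof -
  interpret vectorspace class_ring "module_mat TYPE(complex) (length vs) (length vs)"
    by (rule matrix_vs)
  show ?thesis
    unfolding adjacency_algebra_def
    by (rule subsetD[OF in_own_span])
      (auto simp: module_mat_simps intro!: pow_carrier_mat adjacency_matrix_carrier)
qed

text \<open>Induction principle for the algebra: the span is the least linear subspace containing
  the powers.\<close>

lemma adjacency_algebra_subset:
  assumes "N \<subseteq> carrier_mat (length vs) (length vs)"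
    and "0\<^sub>m (length vs) (length vs) \<in> N"
    and "\<And>X Y. X \<in> N \<Longrightarrow> Y \<in> N \<Longrightarrow> X + Y \<in> N"
    and "\<And>a X. X \<in> N \<Longrightarrow> a \<cdot>\<^sub>m X \<in> N"
    and "\<And>k. adjmat ^\<^sub>m k \<in> N"
  shows "adjalg \<subseteq> N"
proof -
  interpret vectorspace class_ring "module_mat TYPE(complex) (length vs) (length vs)"
    by (rule matrix_vs)
  show ?thesis
    unfolding adjacency_algebra_def
    by (rule span_is_subset) (use assms submodule_matI[OF assms(1-4)] in auto)
qed

text \<open>The algebra is defined by linear combinations only, so this closure needs an argument:
  the matrices \<open>X\<close> with \<open>X * adjmat\<close> in the algebra form a subspace, and
  it contains every power because multiplication shifts the exponent.\<close>

lemma adjacency_algebra_mult_adjacency_matrix: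
  assumes "X \<in> adjalg"
  shows "X * adjmat \<in> adjalg"
proof -
  let ?n = "length vs"
  have "adjalg \<subseteq> {X \<in> carrier_mat ?n ?n. X * adjmat \<in> adjalg}"
  proof (rule adjacency_algebra_subset)
    show "adjmat ^\<^sub>m k \<in> {X \<in> carrier_mat ?n ?n. X * adjmat \<in> adjalg}" for k
      using adjacency_algebra_pow[of "Suc k"] adjacency_matrix_carrier
      by (auto intro: pow_carrier_mat)
  qed (use adjacency_matrix_carrier in
      \<open>auto simp: adjacency_algebra_zero add_mult_distrib_mat[where nr = ?n and n = ?n and nc = ?n]
        mult_smult_assoc_mat[where nr = ?n and n = ?n and nc = ?n]
        intro: adjacency_algebra_add adjacency_algebra_smult\<close>)
  with assms show ?thesis by blast
qed

end

section \<open>Even words as sets, and their Hamming distance\<close>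

definition even_subsets :: "nat \<Rightarrow> nat set set" where
  "even_subsets n = {c. c \<subseteq> {..<n} \<and> even (card c)}"

definition hdist :: "'a set \<Rightarrow> 'a set \<Rightarrow> nat" where
  "hdist a b = card (sym_diff a b)"

lemma hdist_commute: "hdist a b = hdist b a"
  by (simp add: hdist_def Un_commute)

lemma hdist_self [simp]: "hdist a a = 0"
  by (simp add: hdist_def)

lemma hdist_empty [simp]: "hdist {} a = card a"
  by (simp add: hdist_def)

lemma card_sym_diff:
  assumes "finite a" "finite b"
  shows "card (sym_diff a b) + 2 * card (a \<inter> b) = card a + card b"
proof -
  have "card (sym_diff a b) = card (a - b) + card (b - a)"
    using assms by (intro card_Un_disjoint) auto
  moreover have "card (a - b) + card (a \<inter> b) = card a"
    using assms by (metis card_Int_Diff add.commute)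
  moreover have "card (b - a) + card (a \<inter> b) = card b"
    using assms by (metis card_Int_Diff add.commute Int_commute)
  ultimately show ?thesis by simp
qed

lemma sym_diff_cancel: "sym_diff (sym_diff a b) b = a"
  by blast

lemma finite_even_subsets [simp]: "finite (even_subsets n)"
  by (rule finite_subset[of _ "Pow {..<n}"]) (auto simp: even_subsets_def)

lemma even_subsetsD:
  assumes "c \<in> even_subsets n"
  shows "c \<subseteq> {..<n}" "finite c" "even (card c)" "card c \<le> n"
proof -
  show "c \<subseteq> {..<n}" "even (card c)" using assms by (auto simp: even_subsets_def)
  then show "finite c" "card c \<le> n"
    using finite_subset card_mono[of "{..<n}" c] by fastforce+
qed

lemma empty_in_even_subsets [simp]: "{} \<in> even_subsets n"
  by (simp add: even_subsets_def)

lemma sym_diff_in_even_subsets: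
  assumes "a \<in> even_subsets n" "b \<in> even_subsets n"
  shows "sym_diff a b \<in> even_subsets n"
proof -
  have "even (card (sym_diff a b) + 2 * card (a \<inter> b))"
    using card_sym_diff[of a b] even_subsetsD[OF assms(1)] even_subsetsD[OF assms(2)] by simp
  then show ?thesis
    using assms by (auto simp: even_subsets_def)
qed

lemma compl_in_even_subsets:
  assumes "even n" "c \<in> even_subsets n"
  shows "{..<n} - c \<in> even_subsets n"
  using assms even_subsetsD[OF assms(2)]
  by (simp add: even_subsets_def card_Diff_subset)

lemma even_hdist:
  "a \<in> even_subsets n \<Longrightarrow> b \<in> even_subsets n \<Longrightarrow> even (hdist a b)"
  using sym_diff_in_even_subsets[of a n b] by (simp add: hdist_def even_subsets_def)

lemma hdist_le:
  assumes "a \<subseteq> {..<n}" "b \<subseteq> {..<n}"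
  shows "hdist a b \<le> n"
  unfolding hdist_def using card_mono[of "{..<n}" "sym_diff a b"] assms by auto

lemma hdist_compl_left:
  assumes "a \<subseteq> {..<n}" "b \<subseteq> {..<n}"
  shows "hdist ({..<n} - a) b = n - hdist a b"
proof -
  have "sym_diff ({..<n} - a) b = {..<n} - sym_diff a b"
    using assms by blast
  then show ?thesis
    unfolding hdist_def using assms
    by (simp only:) (subst card_Diff_subset, auto intro: finite_subset)
qed

lemma hdist_compl_right:
  assumes "a \<subseteq> {..<n}" "b \<subseteq> {..<n}"
  shows "hdist a ({..<n} - b) = n - hdist a b"
  using hdist_compl_left[OF assms(2,1)] by (simp add: hdist_commute)

text \<open>Translation by \<open>b\<close> is an involution of the group of even words under
  symmetric difference.\<close>

lemma sum_even_subsets_shift: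
  assumes "b \<in> even_subsets n"
  shows "(\<Sum>c\<in>even_subsets n. F (sym_diff c b)) = (\<Sum>c\<in>even_subsets n. F c)"
  by (rule sum.reindex_bij_witness[where i = "\<lambda>c. sym_diff c b" and j = "\<lambda>c. sym_diff c b"])
    (simp_all only: sym_diff_cancel sym_diff_in_even_subsets assms)

lemma sum_even_subsets_compl:
  assumes "even n"
  shows "(\<Sum>c\<in>even_subsets n. F ({..<n} - c)) = (\<Sum>c\<in>even_subsets n. F c)"
  by (rule sum.reindex_bij_witness[where i = "\<lambda>c. {..<n} - c" and j = "\<lambda>c. {..<n} - c"])
    (auto simp: compl_in_even_subsets assms dest: even_subsetsD(1))

section \<open>The three-term recurrence for functions of the distance\<close>

text \<open>Adding a pair \<open>t\<close> to the word \<open>b\<close> lowers its weight by 2,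
  keeps it or raises it by 2, according to whether \<open>t\<close> has two, one or no elements in
  \<open>b\<close>; the coefficients count these pairs.\<close>

lemma sum_pairs_hdist:
  fixes g :: "nat \<Rightarrow> complex"
  assumes "finite u" "b \<subseteq> u"
  defines "e \<equiv> card b" and "n \<equiv> card u"
  shows "(\<Sum>t | t \<subseteq> u \<and> card t = 2. g (hdist t b)) =
    of_nat (e choose 2) * g (e - 2) + of_nat (e * (n - e)) * g e
      + of_nat ((n - e) choose 2) * g (e + 2)"
proof -
  define t1 t2 t3 where "t1 = {t. t \<subseteq> b \<and> card t = 2}"
    and "t2 = (\<lambda>(x, y). {x, y}) ` (b \<times> (u - b))" and "t3 = {t. t \<subseteq> u - b \<and> card t = 2}"
  have fb: "finite b" using assms finite_subset by blast
  have fin: "finite t1" "finite t2" "finite t3"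
    using assms fb by (auto simp: t1_def t2_def t3_def)
  have "{t. t \<subseteq> u \<and> card t = 2} = t1 \<union> t2 \<union> t3"
    using assms(2) by (auto simp: t1_def t2_def t3_def card_2_iff image_iff)
  moreover have "t1 \<inter> t2 = {}" "(t1 \<union> t2) \<inter> t3 = {}"
    by (auto simp: t1_def t2_def t3_def card_2_iff)
  ultimately have "(\<Sum>t | t \<subseteq> u \<and> card t = 2. g (hdist t b)) =
      (\<Sum>t\<in>t1. g (hdist t b)) + (\<Sum>t\<in>t2. g (hdist t b)) + (\<Sum>t\<in>t3. g (hdist t b))"
    using fin by (simp add: sum.union_disjoint)
  moreover have "hdist t b = e - 2" if "t \<in> t1" for t
  proof -
    have "sym_diff t b = b - t" "finite t"
      using that fb finite_subset by (auto simp: t1_def)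
    with that show ?thesis by (simp add: hdist_def t1_def e_def card_Diff_subset)
  qed
  moreover have "hdist t b = e" if t: "t \<in> t2" for t
  proof -
    from t obtain x y where xy: "t = {x, y}" "x \<in> b" "y \<notin> b" by (auto simp: t2_def)
    then have "sym_diff t b = insert y (b - {x})" by auto
    moreover have "card (insert y (b - {x})) = Suc (card (b - {x}))" using fb xy by simp
    ultimately show ?thesis
      using card_Suc_Diff1[OF fb xy(2)] by (simp add: hdist_def e_def)
  qed
  moreover have "hdist t b = e + 2" if t: "t \<in> t3" for t
  proof -
    have "sym_diff t b = t \<union> b" "t \<inter> b = {}" using t by (auto simp: t3_def)
    moreover have "finite t" using t assms(1) finite_subset by (auto simp: t3_def)
    ultimately show ?thesis
      using t fb by (simp add: hdist_def e_def t3_def card_Un_disjoint)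
  qed
  moreover have "card t1 = e choose 2"
    using n_subsets[OF fb, of 2] by (simp add: t1_def e_def)
  moreover have "card t2 = e * (n - e)"
  proof -
    have "inj_on (\<lambda>(x, y). {x, y}) (b \<times> (u - b))"
      by (auto simp: inj_on_def doubleton_eq_iff)
    then show ?thesis
      using assms fb by (simp add: t2_def card_image card_cartesian_product card_Diff_subset)
  qed
  moreover have "card t3 = (n - e) choose 2"
    using n_subsets[of "u - b" 2] assms fb by (simp add: t3_def card_Diff_subset)
  ultimately show ?thesis by simp
qed

text \<open>The distance-2 adjacency operator of the halved \<open>n\<close>-cube acting on
  functions of the Hamming distance. Where \<open>e - 2\<close> is truncated or \<open>e + 2\<close>
  exceeds \<open>n\<close>, the binomial coefficient in front is 0.\<close>

definition hecke :: "nat \<Rightarrow> (nat \<Rightarrow> complex) \<Rightarrow> nat \<Rightarrow> complex" where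
  "hecke n g e = of_nat (e choose 2) * g (e - 2) + of_nat (e * (n - e)) * g e
      + of_nat ((n - e) choose 2) * g (e + 2)"

text \<open>Translating by \<open>b\<close> turns the words at distance 2 from \<open>b\<close> into
  the two-element sets.\<close>

lemma sum_distance_two:
  assumes "a \<in> even_subsets n" "b \<in> even_subsets n"
  shows "(\<Sum>c\<in>even_subsets n. g (hdist a c) * (if hdist c b = 2 then 1 else 0)) =
    hecke n g (hdist a b)"
proof -
  have eq: "hdist a (sym_diff c b) = hdist c (sym_diff a b)" for c
    unfolding hdist_def by (rule arg_cong[where f = card]) blast
  have "(\<Sum>c\<in>even_subsets n. g (hdist a c) * (if hdist c b = 2 then 1 else 0)) =
      (\<Sum>c\<in>even_subsets n. g (hdist a (sym_diff c b)) * (if hdist (sym_diff c b) b = 2 then 1 else 0))"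
    using sum_even_subsets_shift[OF assms(2),
        of "\<lambda>c. g (hdist a c) * (if hdist c b = 2 then 1 else 0)"] by simp
  also have "\<dots> = (\<Sum>c\<in>even_subsets n. g (hdist c (sym_diff a b)) * (if card c = 2 then 1 else 0))"
    unfolding eq by (simp only: hdist_def sym_diff_cancel)
  also have "\<dots> = (\<Sum>c | c \<subseteq> {..<n} \<and> card c = 2. g (hdist c (sym_diff a b)))"
    by (rule sum.mono_neutral_cong_right) (auto simp: even_subsets_def)
  also have "\<dots> = hecke n g (hdist a b)"
    using sum_pairs_hdist[of "{..<n}" "sym_diff a b" g] assms
    by (auto simp: hecke_def hdist_def even_subsets_def)
  finally show ?thesis .
qed

section \<open>Functions of the distance as matrices over the antipodal classes\<close>

text \<open>\<open>r l\<close> is one of the two words in the class \<open>vs ! l\<close>.\<close>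

locale folded_enumeration =
  fixes m :: nat and vs :: "'v list" and adj :: "'v \<Rightarrow> 'v \<Rightarrow> bool" and r :: "nat \<Rightarrow> nat set"
  assumes m_ge_2: "m \<ge> 2"
    and cover: "(\<Union>l<length vs. {r l, {..<2 * m} - r l}) = even_subsets (2 * m)"
    and disjoint: "disjoint_family_on (\<lambda>l. {r l, {..<2 * m} - r l}) {..<length vs}"
    and adj_iff: "i < length vs \<Longrightarrow> j < length vs \<Longrightarrow>
      adj (vs ! i) (vs ! j) \<longleftrightarrow> hdist (r i) (r j) \<in> {2, 2 * m - 2}"
begin

abbreviation "v \<equiv> length vs"

abbreviation "E \<equiv> even_subsets (2 * m)"

text \<open>Complementing one of two words replaces their distance \<open>w\<close> by
  \<open>2 * m - w\<close>, so this condition makes \<open>g (hdist a b)\<close> depend only on the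
  antipodal classes of \<open>a\<close> and \<open>b\<close>.\<close>

definition symmetric :: "(nat \<Rightarrow> complex) \<Rightarrow> bool" where
  "symmetric g \<longleftrightarrow> (\<forall>w\<le>2 * m. g (2 * m - w) = g w)"

definition dist_mat :: "(nat \<Rightarrow> complex) \<Rightarrow> complex mat" where
  "dist_mat g = mat v v (\<lambda>(i, j). g (hdist (r i) (r j)))"

abbreviation "nbr_mat \<equiv> adjacency_matrix vs adj"

lemma nbr_mat_eq:
  "nbr_mat = mat v v (\<lambda>(i, j). if hdist (r i) (r j) \<in> {2, 2 * m - 2} then 1 else 0)"
  unfolding adjacency_matrix_def by (rule cong_mat) (simp_all add: adj_iff)

text \<open>For \<open>m = 2\<close> the distances \<open>2\<close> and \<open>2 * m - 2\<close> coincide, so the words at distance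
  \<open>2\<close> from a given word represent every adjacent class twice.\<close>

definition mult_two :: complex where
  "mult_two = (if m = 2 then 1 / 2 else 1)"

lemma r_in_E: "l < v \<Longrightarrow> r l \<in> E"
  using cover by blast

lemma compl_neq: "{..<2 * m} - a \<noteq> a"
proof -
  have "0 \<in> {..<2 * m} - a \<longleftrightarrow> 0 \<notin> a" using m_ge_2 by auto
  then show ?thesis by blast
qed

text \<open>Every class consists of two distinct words. This moves sums over vertices to sums over
  all even words, where translations and characters are available.\<close>

lemma sum_vertices:
  fixes F :: "nat set \<Rightarrow> complex"
  assumes "\<And>c. c \<in> E \<Longrightarrow> F ({..<2 * m} - c) = F c"
  shows "2 * (\<Sum>l<v. F (r l)) = (\<Sum>c\<in>E. F c)"
proof -
  have "(\<Sum>c\<in>E. F c) = (\<Sum>l<v. \<Sum>c\<in>{r l, {..<2 * m} - r l}. F c)"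
    unfolding cover[symmetric]
    by (rule sum.UNION_disjoint) (use disjoint in \<open>simp_all add: disjoint_family_on_def\<close>)
  also have "\<dots> = (\<Sum>l<v. 2 * F (r l))"
  proof (rule sum.cong)
    fix l assume "l \<in> {..<v}"
    then show "(\<Sum>c\<in>{r l, {..<2 * m} - r l}. F c) = 2 * F (r l)"
      using compl_neq[of "r l", symmetric] assms[OF r_in_E[of l]] by simp
  qed simp
  finally show ?thesis by (simp add: sum_distrib_left)
qed

lemma card_E: "2 * v = card E"
  using sum_vertices[of "\<lambda>_. 1"] by (simp flip: of_nat_eq_iff[where 'a = complex])

lemma symmetric_hdist:
  assumes "symmetric g" "a \<in> E" "c \<in> E"
  shows "g (hdist a ({..<2 * m} - c)) = g (hdist a c)"
  using assms(1) hdist_compl_right hdist_le even_subsetsD(1)[OF assms(2)] even_subsetsD(1)[OF assms(3)]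
  by (simp add: symmetric_def)

text \<open>An entry of the product is lifted to a sum over all even words. Those at distance
  \<open>2 * m - 2\<close> from \<open>b\<close> are the complements of those at distance 2 and
  contribute the same amount, which cancels the factor 2 of \<open>sum_vertices\<close>.\<close>

lemma dist_mat_mult_nbr_mat:
  assumes "symmetric g"
  shows "dist_mat g * nbr_mat = dist_mat (\<lambda>e. mult_two * hecke (2 * m) g e)"
proof (rule eq_matI)
  fix i j
  assume "i < dim_row (dist_mat (\<lambda>e. mult_two * hecke (2 * m) g e))"
    and "j < dim_col (dist_mat (\<lambda>e. mult_two * hecke (2 * m) g e))"
  then have ij: "i < v" "j < v" by (simp_all add: dist_mat_def)
  define a b where "a = r i" and "b = r j"
  have ab: "a \<in> E" "b \<in> E" using ij r_in_E by (auto simp: a_def b_def)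
  note sub = even_subsetsD(1)[OF ab(1)] even_subsetsD(1)[OF ab(2)]
  let ?ind = "\<lambda>k c. if hdist c b = k then 1 else 0 :: complex"
  define F where "F c = g (hdist a c) * (if hdist c b \<in> {2, 2 * m - 2} then 1 else 0)" for c
  have split: "F c = mult_two * (g (hdist a c) * ?ind 2 c + g (hdist a c) * ?ind (2 * m - 2) c)" for c
    using m_ge_2 by (auto simp: F_def mult_two_def)
  have compl: "hdist ({..<2 * m} - c) b = 2 * m - k \<longleftrightarrow> hdist c b = k" if "c \<in> E" "k \<le> 2 * m" for c k
    using hdist_compl_left[OF even_subsetsD(1)[OF that(1)] sub(2)]
      hdist_le[OF even_subsetsD(1)[OF that(1)] sub(2)] that(2) by linarith
  have "(\<Sum>c\<in>E. g (hdist a c) * ?ind (2 * m - 2) c) =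
      (\<Sum>c\<in>E. g (hdist a ({..<2 * m} - c)) * ?ind (2 * m - 2) ({..<2 * m} - c))"
    using sum_even_subsets_compl[of "2 * m" "\<lambda>c. g (hdist a c) * ?ind (2 * m - 2) c"] by simp
  also have "\<dots> = (\<Sum>c\<in>E. g (hdist a c) * ?ind 2 c)"
  proof (rule sum.cong)
    fix c assume c: "c \<in> E"
    show "g (hdist a ({..<2 * m} - c)) * ?ind (2 * m - 2) ({..<2 * m} - c) = g (hdist a c) * ?ind 2 c"
      using m_ge_2 compl[OF c, of 2] symmetric_hdist[OF assms ab(1) c] by simp
  qed simp
  finally have flipped: "(\<Sum>c\<in>E. g (hdist a c) * ?ind (2 * m - 2) c) = (\<Sum>c\<in>E. g (hdist a c) * ?ind 2 c)" .
  have "F ({..<2 * m} - c) = F c" if "c \<in> E" for c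
  proof -
    have "2 * m - (2 * m - 2) = 2" using m_ge_2 by simp
    then have "hdist ({..<2 * m} - c) b \<in> {2, 2 * m - 2} \<longleftrightarrow> hdist c b \<in> {2, 2 * m - 2}"
      using compl[OF that, of 2] compl[OF that, of "2 * m - 2"] m_ge_2 by (simp add: disj_commute)
    then show ?thesis using symmetric_hdist[OF assms ab(1) that] by (simp only: F_def)
  qed
  then have "2 * (\<Sum>l<v. F (r l)) = (\<Sum>c\<in>E. F c)" by (rule sum_vertices)
  also have "\<dots> = 2 * (mult_two * hecke (2 * m) g (hdist a b))"
    unfolding split sum_distrib_left[symmetric] sum.distrib flipped sum_distance_two[OF ab]
    by simp
  finally have "(\<Sum>l<v. F (r l)) = mult_two * hecke (2 * m) g (hdist a b)" by simp
  then show "(dist_mat g * nbr_mat) $$ (i, j) =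
      dist_mat (\<lambda>e. mult_two * hecke (2 * m) g e) $$ (i, j)"
    using ij by (simp add: dist_mat_def nbr_mat_eq scalar_prod_def F_def a_def b_def
        lessThan_atLeast0)
qed (simp_all add: dist_mat_def nbr_mat_eq)

text \<open>The reflection of \<open>w\<close> to \<open>2 * m - w\<close> interchanges the two
  outer terms of the recurrence and fixes the middle one.\<close>

lemma symmetric_hecke:
  assumes "symmetric g"
  shows "symmetric (\<lambda>e. c * hecke (2 * m) g e)"
  unfolding symmetric_def
proof (intro allI impI)
  fix w assume w: "w \<le> 2 * m"
  have 1: "of_nat ((2 * m - w) choose 2) * g (2 * m - w - 2) = of_nat ((2 * m - w) choose 2) * g (w + 2)"
  proof (cases "w + 2 \<le> 2 * m")
    case True
    then show ?thesis using assms by (auto simp: symmetric_def)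
  qed (simp add: binomial_eq_0)
  have 2: "of_nat (w choose 2) * g (2 * m - w + 2) = of_nat (w choose 2) * g (w - 2)"
  proof (cases "w \<ge> 2")
    case True
    then have "g (2 * m - (w - 2)) = g (w - 2)" 
      using assms[unfolded symmetric_def, rule_format, of "w - 2"] w by linarith
    moreover have "2 * m - (w - 2) = 2 * m - w + 2" using True w by linarith
    ultimately show ?thesis by (simp only:)
  qed (simp add: binomial_eq_0)
  have 3: "g (2 * m - w) = g w" using assms w by (simp add: symmetric_def)
  show "c * hecke (2 * m) g (2 * m - w) = c * hecke (2 * m) g w"
    unfolding hecke_def diff_diff_cancel[OF w] 1 2 3 by (simp add: algebra_simps)
qed

lemma even_hdist_r: "i < v \<Longrightarrow> j < v \<Longrightarrow> even (hdist (r i) (r j))"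
  using even_hdist[OF r_in_E r_in_E] .

lemma hdist_r_le: "i < v \<Longrightarrow> j < v \<Longrightarrow> hdist (r i) (r j) \<le> 2 * m"
  by (simp add: hdist_le r_in_E even_subsetsD(1))

lemma same_class_iff:
  assumes "i < v" "j < v" "a \<in> {r i, {..<2 * m} - r i}" "b \<in> {r j, {..<2 * m} - r j}"
  shows "b \<in> {a, {..<2 * m} - a} \<longleftrightarrow> i = j"
proof -
  have "r i \<subseteq> {..<2 * m}" using r_in_E[OF assms(1)] by (rule even_subsetsD(1))
  then have eq: "{a, {..<2 * m} - a} = {r i, {..<2 * m} - r i}"
    using assms(3) by (auto simp: double_diff)
  show ?thesis
  proof
    assume "b \<in> {a, {..<2 * m} - a}"
    then have "b \<in> {r i, {..<2 * m} - r i} \<inter> {r j, {..<2 * m} - r j}"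
      using assms(4) unfolding eq by (rule IntI)
    then have "{r i, {..<2 * m} - r i} \<inter> {r j, {..<2 * m} - r j} \<noteq> {}" by (metis empty_iff)
    then show "i = j"
      using disjoint assms(1,2) by (auto simp only: disjoint_family_on_def lessThan_iff)
  next
    assume "i = j"
    then show "b \<in> {a, {..<2 * m} - a}" using assms(4) unfolding eq by simp
  qed
qed

lemma hdist_r_eq_0_iff:
  assumes "i < v" "j < v"
  shows "hdist (r i) (r j) = 0 \<longleftrightarrow> i = j"
proof
  assume "hdist (r i) (r j) = 0"
  then have "sym_diff (r i) (r j) = {}"
    using even_subsetsD(2)[OF r_in_E[OF assms(1)]] even_subsetsD(2)[OF r_in_E[OF assms(2)]]
    unfolding hdist_def by (subst (asm) card_0_eq) auto
  then have "r j = r i" by blast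
  then show "i = j"
    using same_class_iff[OF assms, of "r i" "r j"] by simp
qed simp

lemma hdist_r_neq_max:
  assumes "i < v" "j < v"
  shows "hdist (r i) (r j) \<noteq> 2 * m"
proof
  assume *: "hdist (r i) (r j) = 2 * m"
  note sub = even_subsetsD(1)[OF r_in_E[OF assms(1)]] even_subsetsD(1)[OF r_in_E[OF assms(2)]]
  have "hdist ({..<2 * m} - r i) (r j) = 0"
    using hdist_compl_left[OF sub] * by simp
  then have "sym_diff ({..<2 * m} - r i) (r j) = {}"
    using even_subsetsD(2)[OF r_in_E[OF assms(2)]]
    unfolding hdist_def by (subst (asm) card_0_eq) auto
  then have eq: "r j = {..<2 * m} - r i" by blast
  then have "i = j" using same_class_iff[OF assms, of "r i" "r j"] by simp
  with eq show False using compl_neq[of "r i"] by simp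
qed

lemma dist_mat_carrier [simp]: "dist_mat g \<in> carrier_mat v v"
  by (simp add: dist_mat_def)

lemma dist_mat_dims [simp]: "dim_row (dist_mat g) = v" "dim_col (dist_mat g) = v"
  by (simp_all add: dist_mat_def)

lemma dist_mat_cong:
  assumes "\<And>e. even e \<Longrightarrow> e \<le> 2 * m \<Longrightarrow> g e = h e"
  shows "dist_mat g = dist_mat h"
  unfolding dist_mat_def by (rule cong_mat) (simp_all add: assms even_hdist_r hdist_r_le)

lemma dist_mat_add: "dist_mat g + dist_mat h = dist_mat (\<lambda>e. g e + h e)"
  by (rule eq_matI) (simp_all add: dist_mat_def)

lemma dist_mat_smult: "a \<cdot>\<^sub>m dist_mat g = dist_mat (\<lambda>e. a * g e)"
  by (rule eq_matI) (simp_all add: dist_mat_def)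

lemma dist_mat_zero: "dist_mat (\<lambda>_. 0) = 0\<^sub>m v v"
  by (rule eq_matI) (simp_all add: dist_mat_def)

section \<open>Determination of the adjacency algebra\<close>

text \<open>For \<open>w = m\<close> both summands fire and the value at \<open>m\<close> is 2. With
  this convention every symmetric function expands with the same factor 1/2 throughout.\<close>

definition pair_ind :: "nat \<Rightarrow> nat \<Rightarrow> complex" where
  "pair_ind w e = (if e = w then 1 else 0) + (if e + w = 2 * m then 1 else 0)"

lemma symmetric_pair_ind: "w \<le> 2 * m \<Longrightarrow> symmetric (pair_ind w)"
  by (auto simp: symmetric_def pair_ind_def)

lemma dist_mat_pair_ind_0: "dist_mat (pair_ind 0) = 1\<^sub>m v"
  by (rule eq_matI) (simp_all add: dist_mat_def pair_ind_def hdist_r_eq_0_iff hdist_r_neq_max)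

lemma nbr_mat_pow: "\<exists>g. symmetric g \<and> nbr_mat ^\<^sub>m k = dist_mat g"
proof (induction k)
  case 0
  then show ?case
    using symmetric_pair_ind[of 0] dist_mat_pair_ind_0
    by (intro exI[of _ "pair_ind 0"]) (simp add: adjacency_matrix_def)
next
  case (Suc k)
  then obtain g where "symmetric g" "nbr_mat ^\<^sub>m k = dist_mat g" by blast
  then show ?case
    using dist_mat_mult_nbr_mat symmetric_hecke by (metis pow_mat.simps(2))
qed

text \<open>The recurrence is tridiagonal on the pair indicators. The last bracket is
  \<open>pair_ind (w - 2) e\<close> when \<open>w \<ge> 2\<close>, in a form that vanishes for
  smaller \<open>w\<close> instead of being truncated.\<close>

lemma hecke_pair_ind:
  assumes "w \<le> 2 * m" "e \<le> 2 * m"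
  shows "hecke (2 * m) (pair_ind w) e = of_nat ((w + 2) choose 2) * pair_ind (w + 2) e
    + of_nat (w * (2 * m - w)) * pair_ind w e
    + of_nat ((2 * m - w + 2) choose 2) *
        ((if e + 2 = w then 1 else 0) + (if 2 * m - e + 2 = w then 1 else 0))"
proof -
  have 1: "of_nat (e choose 2) * (if e - 2 = w then 1 else 0 :: complex) =
      of_nat ((w + 2) choose 2) * (if e = w + 2 then 1 else 0)"
    by (cases "e \<ge> 2") (auto simp: binomial_eq_0)
  have 2: "of_nat (e choose 2) * (if e - 2 + w = 2 * m then 1 else 0 :: complex) =
      of_nat ((2 * m - w + 2) choose 2) * (if 2 * m - e + 2 = w then 1 else 0)"
  proof (cases "e \<ge> 2")
    case True
    then have "e - 2 + w = 2 * m \<longleftrightarrow> 2 * m - e + 2 = w" using assms by linarith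
    moreover have "2 * m - w + 2 = e" if "2 * m - e + 2 = w" using that True assms by linarith
    ultimately show ?thesis by (cases "2 * m - e + 2 = w") simp_all
  next
    case False
    then have "2 * m - e + 2 \<noteq> w" using assms by linarith
    with False show ?thesis by (simp add: binomial_eq_0)
  qed
  have 3: "of_nat ((2 * m - e) choose 2) * (if e + 2 = w then 1 else 0 :: complex) =
      of_nat ((2 * m - w + 2) choose 2) * (if e + 2 = w then 1 else 0)"
  proof (cases "e + 2 = w")
    case True
    then have "2 * m - w + 2 = 2 * m - e" using assms by linarith
    then show ?thesis by (simp only:)
  qed simp
  have 4: "of_nat ((2 * m - e) choose 2) * (if e + 2 + w = 2 * m then 1 else 0 :: complex) =
      of_nat ((w + 2) choose 2) * (if e + (w + 2) = 2 * m then 1 else 0)"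
  proof (cases "e + 2 + w = 2 * m")
    case True
    then have "2 * m - e = w + 2" "e + (w + 2) = 2 * m" by linarith+
    with True show ?thesis by (simp only:)
  qed simp
  have 5: "of_nat (e * (2 * m - e)) * pair_ind w e = of_nat (w * (2 * m - w)) * pair_ind w e"
  proof (cases "e + w = 2 * m")
    case True
    then have "2 * m - e = w" "2 * m - w = e" by linarith+
    then show ?thesis by (simp only: mult.commute)
  qed (auto simp: pair_ind_def)
  have "hecke (2 * m) (pair_ind w) e = of_nat (e choose 2) * (if e - 2 = w then 1 else 0)
      + of_nat (e choose 2) * (if e - 2 + w = 2 * m then 1 else 0)
      + of_nat (e * (2 * m - e)) * pair_ind w e
      + of_nat ((2 * m - e) choose 2) * (if e + 2 = w then 1 else 0)
      + of_nat ((2 * m - e) choose 2) * (if e + 2 + w = 2 * m then 1 else 0)"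
    unfolding hecke_def pair_ind_def distrib_left by (simp only: add.assoc)
  also have "\<dots> = of_nat ((w + 2) choose 2) * pair_ind (w + 2) e
    + of_nat (w * (2 * m - w)) * pair_ind w e
    + of_nat ((2 * m - w + 2) choose 2) *
        ((if e + 2 = w then 1 else 0) + (if 2 * m - e + 2 = w then 1 else 0))"
    unfolding 1 2 3 4 5 unfolding pair_ind_def[of "w + 2"] distrib_left by (simp only: ac_simps)
  finally show ?thesis .
qed

text \<open>The coefficient of \<open>pair_ind (w + 2)\<close> in the recurrence is nonzero, so the
  recurrence can be solved for it in terms of its two predecessors and the product with
  \<open>nbr_mat\<close>.\<close>

lemma dist_mat_pair_ind_in_algebra:
  "2 * k \<le> 2 * m \<Longrightarrow> dist_mat (pair_ind (2 * k)) \<in> adjacency_algebra vs adj"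
proof (induction k rule: less_induct)
  case (less k)
  show ?case
  proof (cases k)
    case 0
    have "nbr_mat ^\<^sub>m 0 \<in> adjacency_algebra vs adj" by (rule adjacency_algebra_pow)
    then show ?thesis using 0 dist_mat_pair_ind_0 by (simp add: adjacency_matrix_def)
  next
    case (Suc j)
    define w where "w = 2 * j"
    have w: "w \<le> 2 * m" "2 * k = w + 2" using less.prems Suc by (auto simp: w_def)
    \<comment> \<open>On even \<open>e \<le> 2 * m\<close> this is the indicator two steps below
      \<open>2 * k\<close>, or 0 if \<open>w = 0\<close>.\<close>
    define p where
      "p e = (if e + 2 = w then 1 else 0) + (if 2 * m - e + 2 = w then 1 else 0 :: complex)" for e
    have p: "dist_mat p \<in> adjacency_algebra vs adj"
    proof (cases j)
      case 0
      then have "p = (\<lambda>_. 0)" by (auto simp: p_def w_def)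
      then show ?thesis using adjacency_algebra_zero dist_mat_zero by metis
    next
      case (Suc i)
      then have "dist_mat p = dist_mat (pair_ind (2 * i))"
        by (intro dist_mat_cong) (auto simp: p_def w_def pair_ind_def)
      then show ?thesis using less.IH[of i] less.prems Suc \<open>k = Suc j\<close> by simp
    qed
    have step: "dist_mat (pair_ind w) * nbr_mat \<in> adjacency_algebra vs adj"
      using less.IH[of j] less.prems Suc
      by (intro adjacency_algebra_mult_adjacency_matrix) (simp add: w_def)
    define x y z where "x = mult_two * of_nat ((w + 2) choose 2)"
      and "y = of_nat (w * (2 * m - w)) * mult_two"
      and "z = of_nat ((2 * m - w + 2) choose 2) * mult_two"
    have "mult_two \<noteq> 0" by (simp add: mult_two_def)
    moreover have "((w + 2) choose 2) \<noteq> 0" by (simp add: binomial_eq_0_iff)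
    ultimately have "x \<noteq> 0" unfolding x_def by (metis mult_eq_0_iff of_nat_eq_0_iff)
    have "dist_mat (pair_ind (w + 2)) = (1 / x) \<cdot>\<^sub>m (dist_mat (pair_ind w) * nbr_mat)
      + ((- y / x) \<cdot>\<^sub>m dist_mat (pair_ind w) + (- z / x) \<cdot>\<^sub>m dist_mat p)"
      unfolding dist_mat_mult_nbr_mat[OF symmetric_pair_ind[OF w(1)]] dist_mat_smult dist_mat_add
    proof (rule dist_mat_cong)
      fix e assume "even e" "e \<le> 2 * m"
      have "mult_two * hecke (2 * m) (pair_ind w) e = x * pair_ind (w + 2) e + y * pair_ind w e + z * p e"
        unfolding hecke_pair_ind[OF w(1) \<open>e \<le> 2 * m\<close>] x_def y_def z_def p_def
        by (simp only: distrib_left ac_simps)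
      then show "pair_ind (w + 2) e = 1 / x * (mult_two * hecke (2 * m) (pair_ind w) e) +
         (- y / x * pair_ind w e + - z / x * p e)"
        using \<open>x \<noteq> 0\<close> by (simp add: field_simps)
    qed
    moreover have "dist_mat (pair_ind w) \<in> adjacency_algebra vs adj"
      using less.IH[of j] less.prems Suc by (simp add: w_def)
    ultimately show ?thesis
      unfolding w(2) using step p
      by (auto intro!: adjacency_algebra_add adjacency_algebra_smult)
  qed
qed

theorem adjacency_algebra_eq: "adjacency_algebra vs adj = {dist_mat g | g. symmetric g}"
proof
  show "adjacency_algebra vs adj \<subseteq> {dist_mat g | g. symmetric g}"
  proof (rule adjacency_algebra_subset)
    show "0\<^sub>m v v \<in> {dist_mat g | g. symmetric g}"
      using dist_mat_zero[symmetric] by (auto simp: symmetric_def)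
    show "X + Y \<in> {dist_mat g | g. symmetric g}"
      if "X \<in> {dist_mat g | g. symmetric g}" "Y \<in> {dist_mat g | g. symmetric g}" for X Y
    proof -
      from that obtain g h where "X = dist_mat g" "Y = dist_mat h" "symmetric g" "symmetric h"
        by blast
      then show ?thesis
        by (auto simp: dist_mat_add symmetric_def intro!: exI[of _ "\<lambda>e. g e + h e"])
    qed
    show "a \<cdot>\<^sub>m X \<in> {dist_mat g | g. symmetric g}"
      if "X \<in> {dist_mat g | g. symmetric g}" for a X
    proof -
      from that obtain g where "X = dist_mat g" "symmetric g" by blast
      then show ?thesis
        by (auto simp: dist_mat_smult symmetric_def intro!: exI[of _ "\<lambda>e. a * g e"])
    qed
    show "nbr_mat ^\<^sub>m k \<in> {dist_mat g | g. symmetric g}" for k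
      using nbr_mat_pow[of k] by blast
  qed auto
  show "{dist_mat g | g. symmetric g} \<subseteq> adjacency_algebra vs adj"
  proof safe
    fix g assume g: "symmetric g"
    have part: "K \<le> m \<Longrightarrow> dist_mat (\<lambda>e. \<Sum>k\<le>K. g (2 * k) / 2 * pair_ind (2 * k) e)
        \<in> adjacency_algebra vs adj" for K
    proof (induction K)
      case 0
      then show ?case
        using adjacency_algebra_smult[OF dist_mat_pair_ind_in_algebra[of 0], of "g 0 / 2"]
        by (simp add: dist_mat_smult)
    next
      case (Suc K)
      then show ?case
        using adjacency_algebra_add[OF Suc.IH
            adjacency_algebra_smult[OF dist_mat_pair_ind_in_algebra[of "Suc K"], of "g (2 * Suc K) / 2"]]
        by (simp add: dist_mat_smult dist_mat_add)
    qed
    \<comment> \<open>Each pair of distances \<open>2 * j\<close> and \<open>2 * (m - j)\<close> is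
      met twice as \<open>k\<close> runs up to \<open>m\<close>, or once with value 2 if they
      coincide; the factor 1/2 compensates.\<close>
    have "dist_mat g = dist_mat (\<lambda>e. \<Sum>k\<le>m. g (2 * k) / 2 * pair_ind (2 * k) e)"
    proof (rule dist_mat_cong)
      fix e assume "even e" "e \<le> 2 * m"
      then obtain j where j: "e = 2 * j" "j \<le> m" by auto
      have "(\<Sum>k\<le>m. g (2 * k) / 2 * pair_ind (2 * k) e) =
        (\<Sum>k\<le>m. (if k = j then g (2 * k) / 2 else 0) + (if k = m - j then g (2 * k) / 2 else 0))"
        using j by (intro sum.cong) (auto simp: pair_ind_def)
      also have "\<dots> = g (2 * j) / 2 + g (2 * (m - j)) / 2"
        using j by (simp add: sum.distrib)
      also have "g (2 * (m - j)) = g (2 * j)"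
        using g j by (simp add: symmetric_def diff_mult_distrib2)
      finally show "g e = (\<Sum>k\<le>m. g (2 * k) / 2 * pair_ind (2 * k) e)"
        using j by simp
    qed
    with part[of m] show "dist_mat g \<in> adjacency_algebra vs adj" by simp
  qed
qed

end

section \<open>Characters of the even words and the quadratic form\<close>

text \<open>The character, attached to \<open>d\<close>, of the group of sets under symmetric
  difference.\<close>

definition chi :: "'a set \<Rightarrow> 'a set \<Rightarrow> complex" where
  "chi d c = (- 1) ^ card (d \<inter> c)"

lemma neg_one_power_card_sym_diff:
  assumes "finite a" "finite b"
  shows "(- 1 :: complex) ^ card (sym_diff a b) = (- 1) ^ card a * (- 1) ^ card b"
proof -
  have "(- 1 :: complex) ^ card (sym_diff a b) = (- 1) ^ (card (sym_diff a b) + 2 * card (a \<inter> b))"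
    by (simp add: power_add power_mult)
  then show ?thesis by (simp add: card_sym_diff[OF assms] power_add)
qed

lemma chi_sym_diff_right:
  assumes "finite a" "finite b"
  shows "chi d (sym_diff a b) = chi d a * chi d b"
proof -
  have "d \<inter> sym_diff a b = sym_diff (d \<inter> a) (d \<inter> b)" by blast
  with assms show ?thesis by (simp add: chi_def neg_one_power_card_sym_diff)
qed

lemma chi_sym_diff_left:
  assumes "finite a" "finite b"
  shows "chi (sym_diff a b) d = chi a d * chi b d"
  using chi_sym_diff_right[OF assms, of d] by (simp add: chi_def Int_commute)

lemma chi_square [simp]: "chi d c * chi d c = 1"
  by (simp add: chi_def flip: power_add mult_2)

lemma cnj_chi [simp]: "cnj (chi d c) = chi d c"
  by (simp add: chi_def)

text \<open>A character attached to an even word is trivial on the all-ones word, so it descends to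
  the antipodal classes.\<close>

lemma chi_compl:
  fixes n :: nat
  assumes "even (card d)" "d \<subseteq> {..<n}" "c \<subseteq> {..<n}"
  shows "chi d ({..<n} - c) = chi d c"
proof -
  have fin: "finite c" using assms(3) by (rule finite_subset) simp
  have "d \<inter> {..<n} = d" using assms(2) by blast
  then have "chi d {..<n} = 1" using assms(1) by (simp add: chi_def)
  moreover have "{..<n} - c = sym_diff {..<n} c" using assms(3) by blast
  ultimately show ?thesis using chi_sym_diff_right[of "{..<n}" c d] fin
    by (simp only: finite_lessThan mult_1_left)
qed

text \<open>Translation by \<open>{i, j}\<close> with \<open>i \<in> d\<close> and \<open>j \<notin> d\<close> reverses the sign of every term.\<close>

lemma sum_chi_eq_0:
  assumes "d \<subseteq> {..<n}" "d \<noteq> {}" "d \<noteq> {..<n}"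
  shows "(\<Sum>c\<in>even_subsets n. chi d c) = 0"
proof -
  from assms obtain i j where ij: "i \<in> d" "j \<in> {..<n}" "j \<notin> d" by blast
  then have "i \<noteq> j" "i < n" using assms(1) by auto
  then have p: "{i, j} \<in> even_subsets n" using ij by (simp add: even_subsets_def)
  have "d \<inter> {i, j} = {i}" using ij by auto
  then have "chi d {i, j} = - 1" by (simp add: chi_def)
  then have neg: "chi d (sym_diff c {i, j}) = - chi d c" if "c \<in> even_subsets n" for c
    using chi_sym_diff_right[of c "{i, j}" d] even_subsetsD(2)[OF that] by simp
  have "(\<Sum>c\<in>even_subsets n. chi d c) = (\<Sum>c\<in>even_subsets n. - chi d c)"
    using sum_even_subsets_shift[OF p, of "chi d"] neg by simp
  then show ?thesis by (simp add: sum_negf)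
qed

text \<open>Using the point \<open>k\<close> as a parity bit embeds the subsets of
  \<open>{..<k}\<close>.\<close>

lemma card_even_subsets_ge: "2 ^ k \<le> card (even_subsets (Suc k))"
proof -
  define f where "f s = (if even (card s) then s else insert k s)" for s
  have "f s \<in> even_subsets (Suc k)" if "s \<subseteq> {..<k}" for s
  proof -
    have "finite s" "k \<notin> s" using that finite_subset by auto
    with that show ?thesis by (auto simp: f_def even_subsets_def)
  qed
  moreover have "f s \<inter> {..<k} = s" if "s \<subseteq> {..<k}" for s
    using that by (auto simp: f_def)
  then have "inj_on f (Pow {..<k})" by (metis inj_onI PowD)
  ultimately have "card (Pow {..<k}) \<le> card (even_subsets (Suc k))"
    by (intro card_inj_on_le[of f]) auto
  then show ?thesis by (simp add: card_Pow)
qed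

text \<open>Halving the formula for the size of a symmetric difference shows that half the weight
  modulo 2 is a quadratic form, whose bilinear form is the parity of the intersection.\<close>

lemma quadratic_polarization:
  assumes "a \<in> even_subsets n" "c \<in> even_subsets n"
  shows "(- 1 :: complex) ^ (hdist a c div 2) =
    (- 1) ^ (card a div 2) * (- 1) ^ (card c div 2) * chi a c"
proof -
  note a = even_subsetsD[OF assms(1)] and c = even_subsetsD[OF assms(2)]
  have "hdist a c + 2 * card (a \<inter> c) = card a + card c"
    using card_sym_diff[OF a(2) c(2)] by (simp add: hdist_def)
  moreover have "even (hdist a c)" using assms by (rule even_hdist)
  ultimately have "hdist a c div 2 + 2 * card (a \<inter> c) = card a div 2 + card c div 2 + card (a \<inter> c)"
    using a(3) c(3) by (auto elim!: evenE)
  then have "(- 1 :: complex) ^ (hdist a c div 2 + 2 * card (a \<inter> c)) =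
      (- 1) ^ (card a div 2 + card c div 2 + card (a \<inter> c))" by (simp only:)
  then show ?thesis by (simp add: power_add power_mult chi_def)
qed

section \<open>A real Hadamard matrix for even \<open>m\<close>\<close>

context folded_enumeration
begin

text \<open>For entries 1 and -1 division is multiplication. By polarization, the product of two
  rows is up to sign the character of the sum of their words, and for distinct classes that sum is
  neither empty nor the all-ones word, so the character sum vanishes.\<close>

lemma ex_Hadamard:
  assumes "even m"
  shows "\<exists>W \<in> adjacency_algebra vs adj. complex_Hadamard W"
proof -
  define q :: "nat \<Rightarrow> complex" where "q e = (- 1) ^ (e div 2)" for e
  \<comment> \<open>For even \<open>m\<close> the function \<open>q\<close> violates
    \<open>symmetric\<close> at odd arguments; \<open>h\<close> repairs this and gives the same
    matrix, since only even distances occur.\<close>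
  define h :: "nat \<Rightarrow> complex" where "h e = (if even e then q e else 0)" for e
  have q1: "cmod (q e) = 1" and qq: "x / q e = x * q e" for e x
    by (simp_all add: q_def norm_power) (cases "even (e div 2)"; simp)
  have symq: "q (2 * m - w) = q w" if "w \<le> 2 * m" "even w" for w
  proof -
    obtain j where j: "w = 2 * j" using \<open>even w\<close> by blast
    \<comment> \<open>This is where the parity of \<open>m\<close> enters.\<close>
    have "(- 1 :: complex) ^ (m - j) = (- 1) ^ j"
      using assms j that by (simp add: minus_one_power_iff)
    then show ?thesis using j by (simp add: q_def flip: right_diff_distrib')
  qed
  have "symmetric h"
    using symq by (auto simp: symmetric_def h_def)
  moreover have "dist_mat q = dist_mat h" by (rule dist_mat_cong) (simp add: h_def)
  ultimately have "dist_mat q \<in> adjacency_algebra vs adj" unfolding adjacency_algebra_eq by blast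
  moreover have "complex_Hadamard (dist_mat q)"
  proof -
    have "(\<Sum>l<v. q (hdist (r a) (r l)) * q (hdist (r b) (r l))) = (if a = b then of_nat v else 0)"
      if ab: "a < v" "b < v" for a b
    proof (cases "a = b")
      case True
      have "q e * q e = 1" for e by (simp add: q_def flip: power_add mult_2)
      with True show ?thesis by simp
    next
      case False
      note E = r_in_E[OF ab(1)] r_in_E[OF ab(2)]
      note sub = even_subsetsD(1)[OF E(1)] even_subsetsD(1)[OF E(2)]
      note fin = even_subsetsD(2)[OF E(1)] even_subsetsD(2)[OF E(2)]
      let ?F = "\<lambda>c. q (hdist (r a) c) * q (hdist (r b) c)"
      have "?F ({..<2 * m} - c) = ?F c" if "c \<in> E" for c
        using even_subsetsD(1)[OF that] sub E that
        by (simp add: hdist_compl_right symq hdist_le even_hdist)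
      then have "2 * (\<Sum>l<v. ?F (r l)) = (\<Sum>c\<in>E. ?F c)" by (rule sum_vertices)
      also have "\<dots> = (\<Sum>c\<in>E. q (card (r a)) * q (card (r b)) * chi (sym_diff (r a) (r b)) c)"
      proof (rule sum.cong)
        fix c assume c: "c \<in> E"
        have "q (card c) * q (card c) = 1" by (simp add: q_def flip: power_add mult_2)
        moreover have "?F c = q (card (r a)) * q (card (r b)) * (chi (r a) c * chi (r b) c) *
            (q (card c) * q (card c))"
          unfolding q_def quadratic_polarization[OF E(1) c] quadratic_polarization[OF E(2) c]
          by (simp only: ac_simps)
        ultimately show "?F c = q (card (r a)) * q (card (r b)) * chi (sym_diff (r a) (r b)) c"
          by (simp only: chi_sym_diff_left[OF fin] mult_1_right)
      qed simp
      also have "\<dots> = q (card (r a)) * q (card (r b)) * (\<Sum>c\<in>E. chi (sym_diff (r a) (r b)) c)"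
        by (simp only: sum_distrib_left)
      also have "(\<Sum>c\<in>E. chi (sym_diff (r a) (r b)) c) = 0"
      proof (rule sum_chi_eq_0)
        show "sym_diff (r a) (r b) \<subseteq> {..<2 * m}" using sub by blast
        show "sym_diff (r a) (r b) \<noteq> {}"
          using False hdist_r_eq_0_iff[OF ab] by (metis card.empty hdist_def)
        show "sym_diff (r a) (r b) \<noteq> {..<2 * m}"
          using hdist_r_neq_max[OF ab] by (metis card_lessThan hdist_def)
      qed
      finally show ?thesis using False by simp
    qed
    moreover have "q e \<noteq> 0" for e by (simp add: q_def)
    ultimately show ?thesis
      unfolding complex_Hadamard_def type_II_def by (simp add: dist_mat_def q1 qq)
  qed
  ultimately show ?thesis by blast
qed

end

section \<open>Krawtchouk sums and their strict bound\<close>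

text \<open>The generating function of the Krawtchouk numbers at \<open>N\<close> for words of length
  \<open>2 * N + 2\<close>: the \<open>N\<close> factors \<open>1 - x\<close> and \<open>N\<close> of the \<open>N + 2\<close> factors \<open>1 + x\<close> pair off
  to \<open>1 - x\<^sup>2\<close>.\<close>

lemma krawtchouk_generating_function:
  "(\<Sum>c\<in>Pow {..<2 * N + 2}. monom (chi {..<N} c) (card c)) =
    (\<Sum>k\<le>N. let a = (- 1) ^ k * of_nat (N choose k)
      in monom a (2 * k) + monom (2 * a) (2 * k + 1) + monom a (2 * k + 2))"
proof -
  let ?eps = "\<lambda>i. if i < N then - 1 else 1 :: complex"
  have chi_prod: "chi {..<N} c = (\<Prod>i\<in>c. ?eps i)" if "c \<subseteq> {..<2 * N + 2}" for c
  proof -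
    have "finite c" using that finite_subset by blast
    then have "(\<Prod>i\<in>c. ?eps i) = (- 1) ^ card {i \<in> c. i < N}"
      by (simp add: prod.If_cases Int_def)
    moreover have "{i \<in> c. i < N} = {..<N} \<inter> c" by auto
    ultimately show ?thesis by (simp add: chi_def)
  qed
  have monom_prod: "monom (\<Prod>i\<in>c. ?eps i) (card c) = (\<Prod>i\<in>c. monom (?eps i) 1)"
    if "finite c" for c :: "nat set"
    using that
  proof (induction c)
    case (insert x F)
    have "monom (?eps x * (\<Prod>i\<in>F. ?eps i)) (1 + card F) =
        monom (?eps x) 1 * monom (\<Prod>i\<in>F. ?eps i) (card F)"
      by (simp only: mult_monom)
    with insert show ?case by simp
  qed simp
  \<comment> \<open>The left side is the expansion of the product over all coordinates
    \<open>i\<close> of \<open>1 + ?eps i * x\<close>, where \<open>c\<close> records the factors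
    that contribute \<open>x\<close>.\<close>
  have "(\<Sum>c\<in>Pow {..<2 * N + 2}. monom (chi {..<N} c) (card c)) =
      (\<Sum>c\<in>Pow {..<2 * N + 2}. (\<Prod>i\<in>c. monom (?eps i) 1) * (\<Prod>i\<in>{..<2 * N + 2} - c. 1))"
  proof (rule sum.cong)
    fix c assume c: "c \<in> Pow {..<2 * N + 2}"
    then have "finite c" using finite_subset by blast
    with c show "monom (chi {..<N} c) (card c) =
        (\<Prod>i\<in>c. monom (?eps i) 1) * (\<Prod>i\<in>{..<2 * N + 2} - c. 1)"
      by (simp add: chi_prod monom_prod)
  qed simp
  also have "\<dots> = (\<Prod>i<2 * N + 2. monom (?eps i) 1 + 1)"
    by (rule prod_add[symmetric]) simp
  also have "\<dots> = (monom (- 1) 1 + 1) ^ N * (monom 1 1 + 1) ^ (N + 2)"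
  proof -
    have "{..<2 * N + 2} = {..<N} \<union> {N..<2 * N + 2}" by auto
    then show ?thesis by (simp add: prod.union_disjoint ivl_disj_int)
  qed
  also have "\<dots> = ((monom (- 1) 1 + 1) * (monom 1 1 + 1)) ^ N * (monom 1 1 + 1)\<^sup>2"
    by (simp only: power_add power_mult_distrib mult.assoc)
  also have "(monom (- 1) 1 + 1) * (monom 1 1 + 1 :: complex poly) = monom (- 1) 2 + 1"
    by (simp add: numeral_2_eq_2 monom_Suc monom_0 one_pCons)
  also have "(monom (- 1) 2 + 1 :: complex poly) ^ N =
      (\<Sum>k\<le>N. monom ((- 1) ^ k * of_nat (N choose k)) (2 * k))"
    unfolding binomial_ring
  proof (rule sum.cong)
    fix k
    show "of_nat (N choose k) * monom (- 1) 2 ^ k * 1 ^ (N - k) =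
        (monom ((- 1) ^ k * of_nat (N choose k)) (2 * k) :: complex poly)"
      by (simp add: monom_power of_nat_monom mult_monom mult.commute)
  qed simp
  also have "(monom 1 1 + 1 :: complex poly)\<^sup>2 = monom 1 0 + monom 2 1 + monom 1 2"
    by (simp add: power2_eq_square numeral_2_eq_2 monom_Suc monom_0 one_pCons)
  also have "(\<Sum>k\<le>N. monom ((- 1) ^ k * of_nat (N choose k)) (2 * k)) *
      (monom 1 0 + monom 2 1 + monom 1 2 :: complex poly) =
      (\<Sum>k\<le>N. let a = (- 1) ^ k * of_nat (N choose k)
        in monom a (2 * k) + monom (2 * a) (2 * k + 1) + monom a (2 * k + 2))"
    unfolding sum_distrib_right Let_def
    by (intro sum.cong refl)
      (simp only: distrib_left mult_monom mult_1_right add_0_right, simp only: mult.commute)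
  finally show ?thesis .
qed

text \<open>The generating function is evaluated under the linear functional sending the
  \<open>j\<close>-th power of the variable to \<open>h j\<close>. As \<open>h\<close> vanishes at
  odd arguments, the middle terms of degree \<open>2 * k + 1\<close> drop out.\<close>

lemma sum_chi_weight:
  fixes g :: "nat \<Rightarrow> complex"
  shows "(\<Sum>c\<in>even_subsets (2 * N + 2). chi {..<N} c * g (card c)) =
    (\<Sum>k\<le>N. (- 1) ^ k * of_nat (N choose k) * (g (2 * k) + g (2 * k + 2)))"
proof -
  define h where "h e = (if even e then g e else 0)" for e
  define L where "L p = (\<Sum>j\<le>2 * N + 2. coeff p j * h j)" for p
  have L_add: "L (p + q) = L p + L q" for p q
    by (simp add: L_def distrib_right sum.distrib)
  have L_0: "L 0 = 0" by (simp add: L_def)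
  have L_sum: "L (\<Sum>x\<in>A. f x) = (\<Sum>x\<in>A. L (f x))" for A and f :: "'b \<Rightarrow> complex poly"
    by (induction A rule: infinite_finite_induct) (simp_all add: L_add L_0)
  have L_monom: "L (monom a j) = a * h j" if "j \<le> 2 * N + 2" for a j
    using that by (simp add: L_def if_distrib[of "\<lambda>x. x * _"] cong: if_cong)
  have "(\<Sum>c\<in>even_subsets (2 * N + 2). chi {..<N} c * g (card c)) =
      (\<Sum>c\<in>Pow {..<2 * N + 2}. chi {..<N} c * h (card c))"
    by (rule sum.mono_neutral_cong_left) (auto simp: even_subsets_def h_def)
  also have "\<dots> = (\<Sum>c\<in>Pow {..<2 * N + 2}. L (monom (chi {..<N} c) (card c)))"
  proof (rule sum.cong)
    fix c assume "c \<in> Pow {..<2 * N + 2}"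
    then have "card c \<le> 2 * N + 2" using card_mono[of "{..<2 * N + 2}" c] by simp
    then show "chi {..<N} c * h (card c) = L (monom (chi {..<N} c) (card c))"
      by (simp add: L_monom)
  qed simp
  also have "\<dots> = (\<Sum>k\<le>N. L (let a = (- 1) ^ k * of_nat (N choose k)
      in monom a (2 * k) + monom (2 * a) (2 * k + 1) + monom a (2 * k + 2)))"
    unfolding L_sum[symmetric] krawtchouk_generating_function ..
  also have "\<dots> = (\<Sum>k\<le>N. (- 1) ^ k * of_nat (N choose k) * (g (2 * k) + g (2 * k + 2)))"
    by (rule sum.cong) (simp_all add: Let_def L_add L_monom h_def distrib_left)
  finally show ?thesis .
qed

text \<open>The term \<open>g 2\<close> occurs with opposite signs for \<open>k = 0\<close> and \<open>k = 1\<close>, which makes the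
  triangle inequality strict.\<close>

lemma norm_alternating_binomial_sum_less:
  fixes g :: "nat \<Rightarrow> complex"
  assumes "N \<ge> 2" and g: "\<And>k. k \<le> N + 1 \<Longrightarrow> cmod (g (2 * k)) = 1"
  shows "cmod (\<Sum>k\<le>N. (- 1) ^ k * of_nat (N choose k) * (g (2 * k) + g (2 * k + 2))) < 2 ^ (N + 1)"
proof -
  let ?t = "\<lambda>k. (- 1) ^ k * of_nat (N choose k) * (g (2 * k) + g (2 * k + 2))"
  have g': "cmod (g 0) = 1" "cmod (g 2) = 1" "cmod (g 4) = 1"
    using g[of 0] g[of 1] g[of 2] assms(1) by simp_all
  have split: "(\<Sum>k\<le>N. f k) = f 0 + f 1 + (\<Sum>k=2..N. f k)" for f :: "nat \<Rightarrow> 'b::comm_monoid_add"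
  proof -
    have "{..N} = {0, 1} \<union> {2..N}" using assms(1) by auto
    then show ?thesis by (simp add: sum.union_disjoint add.assoc)
  qed
  \<comment> \<open>After cancellation the coefficient of \<open>g 2\<close> has absolute value
    \<open>N - 1\<close>, so these two terms are bounded by \<open>2 * N\<close>; bounding them
    separately would give \<open>2 * N + 2\<close>.\<close>
  have "?t 0 + ?t 1 = g 0 - of_nat (N - 1) * g 2 - of_nat N * g 4"
    using assms(1) by (simp add: of_nat_diff algebra_simps eval_nat_numeral)
  also have "cmod \<dots> \<le> cmod (g 0) + cmod (of_nat (N - 1) * g 2) + cmod (of_nat N * g 4)"
    using norm_triangle_ineq4[of "g 0 - of_nat (N - 1) * g 2" "of_nat N * g 4"]
      norm_triangle_ineq4[of "g 0" "of_nat (N - 1) * g 2"] by linarith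
  also have "\<dots> = 2 * N"
    unfolding norm_mult norm_of_nat g' using assms(1) by (simp add: of_nat_diff)
  finally have head: "cmod (?t 0 + ?t 1) \<le> 2 * N" by simp
  have "cmod (\<Sum>k=2..N. ?t k) \<le> (\<Sum>k=2..N. 2 * real (N choose k))"
  proof (rule sum_norm_le)
    fix k assume "k \<in> {2..N}"
    then have "cmod (g (2 * k) + g (2 * k + 2)) \<le> 2"
      using norm_triangle_ineq[of "g (2 * k)" "g (2 * k + 2)"] g[of k] g[of "k + 1"] by simp
    then show "cmod (?t k) \<le> 2 * real (N choose k)"
      by (simp add: norm_mult norm_power mult.commute[of 2] mult_left_mono)
  qed
  also have "\<dots> = 2 * (2 ^ N - 1 - real N)"
  proof -
    have "2 ^ N = (\<Sum>k\<le>N. real (N choose k))"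
      using choose_row_sum[of N] by (metis of_nat_numeral of_nat_power of_nat_sum)
    then show ?thesis
      by (simp add: split[of "\<lambda>k. real (N choose k)"] sum_distrib_left)
  qed
  finally have tail: "cmod (\<Sum>k=2..N. ?t k) \<le> 2 * (2 ^ N - 1 - real N)" .
  have "cmod (\<Sum>k\<le>N. ?t k) \<le> cmod (?t 0 + ?t 1) + cmod (\<Sum>k=2..N. ?t k)"
    unfolding split[of ?t] by (rule norm_triangle_ineq)
  also have "\<dots> < 2 ^ (N + 1)" using head tail by simp
  finally show ?thesis .
qed

section \<open>Eigenvalues of a Hadamard matrix in the algebra, and odd \<open>m\<close>\<close>

context folded_enumeration
begin

lemma class_of:
  assumes "a \<in> E"
  obtains i where "i < v" "a \<in> {r i, {..<2 * m} - r i}"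
  using assms cover by blast

lemma symmetric_class:
  assumes "symmetric g" "i < v" "a \<in> {r i, {..<2 * m} - r i}" "c \<in> E"
  shows "g (hdist a c) = g (hdist (r i) c)"
  using symmetric_hdist[OF assms(1) assms(4) r_in_E[OF assms(2)]] assms(3)
  by (auto simp: hdist_commute)

lemma Hadamard_entries:
  assumes "symmetric g" "complex_Hadamard (dist_mat g)" "a \<in> E" "c \<in> E"
  shows "cmod (g (hdist a c)) = 1"
proof -
  obtain i where i: "i < v" "a \<in> {r i, {..<2 * m} - r i}" using class_of[OF assms(3)] .
  obtain j where j: "j < v" "c \<in> {r j, {..<2 * m} - r j}" using class_of[OF assms(4)] .
  have "g (hdist a c) = g (hdist (r i) c)" by (rule symmetric_class) (use assms i in auto)
  also have "\<dots> = g (hdist c (r i))" by (simp add: hdist_commute)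
  also have "\<dots> = g (hdist (r j) (r i))" by (rule symmetric_class) (use assms i j r_in_E in auto)
  finally show ?thesis
    using assms(2) i j by (simp add: complex_Hadamard_def dist_mat_def)
qed

text \<open>For entries of absolute value 1 the inverse is the conjugate, so the type II condition
  is orthogonality of rows. Each class contributes two words \<open>c\<close>, hence
  \<open>2 * v\<close>.\<close>

lemma Hadamard_orthogonality:
  assumes "symmetric g" "complex_Hadamard (dist_mat g)" "a \<in> E" "b \<in> E"
  shows "(\<Sum>c\<in>E. g (hdist a c) * cnj (g (hdist b c))) =
    (if b \<in> {a, {..<2 * m} - a} then of_nat (2 * v) else 0)"
proof -
  obtain i where i: "i < v" "a \<in> {r i, {..<2 * m} - r i}" using class_of[OF assms(3)] .
  obtain j where j: "j < v" "b \<in> {r j, {..<2 * m} - r j}" using class_of[OF assms(4)] .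
  let ?F = "\<lambda>c. g (hdist (r i) c) * cnj (g (hdist (r j) c))"
  have "(\<Sum>c\<in>E. g (hdist a c) * cnj (g (hdist b c))) = (\<Sum>c\<in>E. ?F c)"
    by (rule sum.cong) (simp_all only: symmetric_class[OF assms(1) i] symmetric_class[OF assms(1) j])
  also have "\<dots> = 2 * (\<Sum>l<v. ?F (r l))"
    by (rule sum_vertices[symmetric])
      (simp only: symmetric_hdist[OF assms(1) r_in_E[OF i(1)]] symmetric_hdist[OF assms(1) r_in_E[OF j(1)]])
  also have "(\<Sum>l<v. ?F (r l)) = (\<Sum>l<v. g (hdist (r i) (r l)) / g (hdist (r j) (r l)))"
  proof (rule sum.cong)
    fix l assume "l \<in> {..<v}"
    then have "cmod (g (hdist (r j) (r l))) = 1"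
      using assms j r_in_E by (intro Hadamard_entries) auto
    then show "?F (r l) = g (hdist (r i) (r l)) / g (hdist (r j) (r l))"
      by (simp add: complex_div_cnj[of _ "g (hdist (r j) (r l))"])
  qed simp
  also have "\<dots> = (if i = j then of_nat v else 0)"
    using assms(2) i(1) j(1) by (simp add: complex_Hadamard_def type_II_def dist_mat_def)
  finally show ?thesis
    using same_class_iff[OF i(1) j(1) i(2) j(2)] by simp
qed

text \<open>\<open>chi u\<close> is an eigenvector of \<open>dist_mat g\<close>, and \<open>dist_mat g\<close> is a multiple of a unitary
  matrix.\<close>

lemma Hadamard_eigenvalue:
  assumes g: "symmetric g" "complex_Hadamard (dist_mat g)"
    and u: "u \<subseteq> {..<2 * m}" "even (card u)"
  shows "(cmod (\<Sum>c\<in>E. chi u c * g (card c)))\<^sup>2 = 4 * real v"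
proof -
  \<comment> \<open>The sum meets every class twice, so \<open>lam\<close> is twice the eigenvalue
    of \<open>dist_mat g\<close> at \<open>chi u\<close>.\<close>
  define lam where "lam = (\<Sum>c\<in>E. chi u c * g (card c))"
  have eig: "(\<Sum>a\<in>E. chi u a * g (hdist a b)) = chi u b * lam" if b: "b \<in> E" for b
  proof -
    have "(\<Sum>a\<in>E. chi u a * g (hdist a b)) =
        (\<Sum>a\<in>E. chi u (sym_diff a b) * g (hdist (sym_diff a b) b))"
      using sum_even_subsets_shift[OF b, of "\<lambda>a. chi u a * g (hdist a b)"] by simp
    also have "\<dots> = (\<Sum>a\<in>E. chi u b * (chi u a * g (card a)))"
    proof (rule sum.cong)
      fix a assume "a \<in> E"
      have "hdist (sym_diff a b) b = card a" by (simp only: hdist_def sym_diff_cancel)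
      then show "chi u (sym_diff a b) * g (hdist (sym_diff a b) b) = chi u b * (chi u a * g (card a))"
        using chi_sym_diff_right[OF even_subsetsD(2)[OF \<open>a \<in> E\<close>] even_subsetsD(2)[OF b]]
        by (simp only: ac_simps)
    qed simp
    finally show ?thesis by (simp add: lam_def sum_distrib_left)
  qed
  \<comment> \<open>The squared norm of the image of \<open>chi u\<close> is computed in two ways:
    from the eigenvalue, and by expanding and using orthogonality of rows.\<close>
  have "of_nat (card E) * (lam * cnj lam) =
      (\<Sum>b\<in>E. (\<Sum>a\<in>E. chi u a * g (hdist a b)) * cnj (\<Sum>a\<in>E. chi u a * g (hdist a b)))"
  proof -
    have "(chi u b * lam) * cnj (chi u b * lam) = lam * cnj lam" for b
    proof -
      have "(chi u b * lam) * cnj (chi u b * lam) = (chi u b * chi u b) * (lam * cnj lam)"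
        by (simp only: complex_cnj_mult cnj_chi ac_simps)
      then show ?thesis by simp
    qed
    then have "(\<Sum>b\<in>E. (\<Sum>a\<in>E. chi u a * g (hdist a b)) * cnj (\<Sum>a\<in>E. chi u a * g (hdist a b))) =
        (\<Sum>b\<in>E. lam * cnj lam)"
      by (intro sum.cong refl) (simp only: eig)
    then show ?thesis by simp
  qed
  also have "\<dots> = (\<Sum>b\<in>E. \<Sum>a\<in>E. \<Sum>a'\<in>E. chi u a * chi u a' * (g (hdist a b) * cnj (g (hdist a' b))))"
    unfolding cnj_sum complex_cnj_mult cnj_chi sum_product
    by (intro sum.cong refl) (simp only: ac_simps)
  also have "\<dots> = (\<Sum>a\<in>E. \<Sum>b\<in>E. \<Sum>a'\<in>E. chi u a * chi u a' * (g (hdist a b) * cnj (g (hdist a' b))))"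
    by (rule sum.swap)
  also have "\<dots> = (\<Sum>a\<in>E. \<Sum>a'\<in>E. \<Sum>b\<in>E. chi u a * chi u a' * (g (hdist a b) * cnj (g (hdist a' b))))"
    by (intro sum.cong refl sum.swap)
  also have "\<dots> = (\<Sum>a\<in>E. \<Sum>a'\<in>E. if a' \<in> {a, {..<2 * m} - a} then of_nat (2 * v) else 0)"
  proof (intro sum.cong refl)
    fix a a' assume a: "a \<in> E" "a' \<in> E"
    have "chi u a * chi u a' = 1" if "a' \<in> {a, {..<2 * m} - a}"
      using that chi_compl[OF u(2,1) even_subsetsD(1)[OF a(1)]] by auto
    then show "(\<Sum>b\<in>E. chi u a * chi u a' * (g (hdist a b) * cnj (g (hdist a' b)))) =
        (if a' \<in> {a, {..<2 * m} - a} then of_nat (2 * v) else 0)"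
      unfolding sum_distrib_left[symmetric] Hadamard_orthogonality[OF g a] by simp
  qed
  \<comment> \<open>Only \<open>a\<close> itself and its complement survive, each contributing
    \<open>2 * v\<close>.\<close>
  also have "\<dots> = (\<Sum>a\<in>E. of_nat (4 * v))"
  proof (rule sum.cong)
    fix a assume a: "a \<in> E"
    have "{a, {..<2 * m} - a} \<subseteq> E" using a compl_in_even_subsets[of "2 * m"] by simp
    then have "(\<Sum>a'\<in>E. if a' \<in> {a, {..<2 * m} - a} then of_nat (2 * v) else 0) =
        (\<Sum>a'\<in>{a, {..<2 * m} - a}. of_nat (2 * v) :: complex)"
      by (intro sum.mono_neutral_cong_right) auto
    also have "\<dots> = of_nat (4 * v)" using compl_neq[of a, symmetric] by simp
    finally show "(\<Sum>a'\<in>E. if a' \<in> {a, {..<2 * m} - a} then of_nat (2 * v) else 0) =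
        (of_nat (4 * v) :: complex)" .
  qed simp
  also have "\<dots> = of_nat (card E) * of_nat (4 * v)" by simp
  finally have "of_nat (card E) * (lam * cnj lam) = of_nat (card E) * of_nat (4 * v)" .
  moreover have "card E \<noteq> 0" using empty_in_even_subsets[of "2 * m"] by (metis card_eq_0_iff empty_iff finite_even_subsets)
  ultimately have "lam * cnj lam = of_nat (4 * v)" by simp
  then have "complex_of_real ((cmod lam)\<^sup>2) = complex_of_real (of_nat (4 * v))"
    by (simp only: complex_norm_square of_real_of_nat_eq)
  then have "(cmod lam)\<^sup>2 = of_nat (4 * v)" by (simp only: of_real_eq_iff)
  then show ?thesis by (simp add: lam_def)
qed

text \<open>For odd \<open>m\<close> the squared eigenvalue sum at the word \<open>{..<N}\<close>
  must equal \<open>4 * v\<close>, which is at least the square of \<open>2 ^ (N + 1)\<close>,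
  whereas the alternating binomial bound is strictly below that.\<close>

lemma even_if_Hadamard:
  assumes "W \<in> adjacency_algebra vs adj" "complex_Hadamard W"
  shows "even m"
proof (rule ccontr)
  assume "odd m"
  define N where "N = m - 1"
  have N: "N \<ge> 2" "even N" "2 * m = 2 * N + 2" "m = N + 1"
    using \<open>odd m\<close> m_ge_2 by (auto simp: N_def elim!: oddE)
  obtain g where g: "symmetric g" "complex_Hadamard (dist_mat g)"
    using assms unfolding adjacency_algebra_eq by blast
  have g1: "cmod (g (2 * k)) = 1" if "k \<le> N + 1" for k
  proof -
    \<comment> \<open>Every even distance up to \<open>2 * m\<close> is realised from the empty
      word, so \<open>g\<close> has absolute value 1 at all of them.\<close>
    have "{..<2 * k} \<in> E" using that N by (auto simp: even_subsets_def)
    then show ?thesis using Hadamard_entries[OF g empty_in_even_subsets] by fastforce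
  qed
  let ?lam = "\<Sum>c\<in>E. chi {..<N} c * g (card c)"
  have "cmod ?lam < 2 ^ (N + 1)"
    unfolding N(3) sum_chi_weight
    using N(1) g1 by (rule norm_alternating_binomial_sum_less)
  then have "(cmod ?lam)\<^sup>2 < (2 ^ (N + 1))\<^sup>2" by (intro power_strict_mono) auto
  moreover have "(cmod ?lam)\<^sup>2 = 4 * real v"
    using g N by (intro Hadamard_eigenvalue) auto
  moreover have "4 * real v = 2 * real (card E)" using card_E by (simp flip: of_nat_mult)
  moreover have "2 ^ (2 * N + 1) \<le> card E"
    using card_even_subsets_ge[of "2 * N + 1"] N(3) by simp
  then have "real (2 ^ (2 * N + 1)) \<le> real (card E)" by (simp only: of_nat_le_iff)
  moreover have "2 * real (2 ^ (2 * N + 1)) = (2 ^ (N + 1))\<^sup>2"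
    by (simp add: power_mult_distrib flip: power_mult)
  ultimately show False by linarith
qed

end

section \<open>From Boolean words and antipodal classes to sets\<close>

definition support :: "bool list \<Rightarrow> nat set" where
  "support a = {i. i < length a \<and> a ! i}"

lemma support_subset: "support a \<subseteq> {..<length a}"
  by (auto simp: support_def)

lemma card_support: "card (support a) = count_list a True"
  by (simp add: support_def count_list_eq_length_filter length_filter_conv_card)

lemma support_map_Not: "support (map Not a) = {..<length a} - support a"
  by (auto simp: support_def)

lemma hdist_support:
  "length a = length b \<Longrightarrow> hdist (support a) (support b) = card {i. i < length a \<and> a ! i \<noteq> b ! i}"
  unfolding hdist_def support_def by (rule arg_cong[where f = card]) auto

lemma support_inject: "length a = length b \<Longrightarrow> support a = support b \<Longrightarrow> a = b"
  by (rule nth_equalityI) (auto simp: support_def set_eq_iff)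

lemma ex_support:
  assumes "c \<subseteq> {..<n}"
  obtains a where "length a = n" "support a = c"
proof
  show "length (map (\<lambda>i. i \<in> c) [0..<n]) = n" by simp
  show "support (map (\<lambda>i. i \<in> c) [0..<n]) = c" using assms by (auto simp: support_def)
qed

lemma halved_cube_verts_iff:
  "a \<in> halved_cube_verts n \<longleftrightarrow> length a = n \<and> support a \<in> even_subsets n"
  using support_subset[of a] by (auto simp: halved_cube_verts_def even_subsets_def card_support)

lemma support_antipodal_class:
  "support ` antipodal_class a = {support a, {..<length a} - support a}"
  by (simp add: antipodal_class_def support_map_Not)

lemma antipodal_class_eq: "b \<in> antipodal_class a \<Longrightarrow> antipodal_class b = antipodal_class a"
  by (auto simp: antipodal_class_def comp_def)

text \<open>Complementing one representative turns distance \<open>d\<close> into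
  \<open>n - d\<close> and complementing both restores \<open>d\<close>, so the four pairs of
  representatives realise only these two distances.\<close>

lemma folded_halved_cube_adj_iff:
  assumes "length a = n" "length b = n" "n \<ge> 2"
  shows "folded_halved_cube_adj (antipodal_class a) (antipodal_class b) \<longleftrightarrow>
    hdist (support a) (support b) \<in> {2, n - 2}"
proof -
  have sub: "support a \<subseteq> {..<n}" "support b \<subseteq> {..<n}"
    using support_subset[of a] support_subset[of b] assms by auto
  have len: "length c = n" if "c \<in> antipodal_class a \<union> antipodal_class b" for c
    using that assms by (auto simp: antipodal_class_def)
  have "folded_halved_cube_adj (antipodal_class a) (antipodal_class b) \<longleftrightarrow>
      (\<exists>x\<in>antipodal_class a. \<exists>y\<in>antipodal_class b. hdist (support x) (support y) = 2)"
    unfolding folded_halved_cube_adj_def halved_cube_adj_def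
    using len by (intro bex_cong refl) (simp add: hdist_support)
  also have "\<dots> \<longleftrightarrow> (\<exists>x\<in>support ` antipodal_class a. \<exists>y\<in>support ` antipodal_class b. hdist x y = 2)"
    by simp
  also have "\<dots> \<longleftrightarrow> hdist (support a) (support b) = 2 \<or> n - hdist (support a) (support b) = 2"
    unfolding support_antipodal_class using assms sub hdist_le[OF sub]
    by (auto simp: hdist_compl_left hdist_compl_right)
  also have "\<dots> \<longleftrightarrow> hdist (support a) (support b) \<in> {2, n - 2}"
    using hdist_le[OF sub] assms(3) by auto
  finally show ?thesis .
qed

text \<open>One word is chosen from each class. If two of the resulting pairs of supports met, the
  classes would share a word and hence be equal, contrary to distinctness of the list.\<close>

lemma folded_enumeration_exists:
  assumes "m \<ge> 2" "distinct vs" "set vs = folded_halved_cube_verts m"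
  shows "\<exists>r. folded_enumeration m vs folded_halved_cube_adj r"
proof -
  have "\<exists>a. a \<in> halved_cube_verts (2 * m) \<and> vs ! l = antipodal_class a" if "l < length vs" for l
    using nth_mem[OF that] unfolding assms(3) folded_halved_cube_verts_def by blast
  then obtain rep where rep: "\<And>l. l < length vs \<Longrightarrow> rep l \<in> halved_cube_verts (2 * m)"
    "\<And>l. l < length vs \<Longrightarrow> vs ! l = antipodal_class (rep l)" by metis
  have len: "length (rep l) = 2 * m" if "l < length vs" for l
    using rep(1)[OF that] by (simp add: halved_cube_verts_def)
  define r where "r l = support (rep l)" for l
  have cls: "{r l, {..<2 * m} - r l} = support ` antipodal_class (rep l)" if "l < length vs" for l
    by (simp add: support_antipodal_class r_def len[OF that])
  have len': "length a = 2 * m" if "a \<in> antipodal_class (rep l)" "l < length vs" for a l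
    using that len by (auto simp: antipodal_class_def)
  have "folded_enumeration m vs folded_halved_cube_adj r"
  proof
    show "(\<Union>l<length vs. {r l, {..<2 * m} - r l}) = even_subsets (2 * m)"
    proof (intro equalityI subsetI)
      fix c assume "c \<in> (\<Union>l<length vs. {r l, {..<2 * m} - r l})"
      then show "c \<in> even_subsets (2 * m)"
        using rep(1) compl_in_even_subsets[of "2 * m"] by (auto simp: r_def halved_cube_verts_iff)
    next
      fix c assume c: "c \<in> even_subsets (2 * m)"
      obtain a where a: "length a = 2 * m" "support a = c"
        using ex_support[OF even_subsetsD(1)[OF c]] .
      then have "antipodal_class a \<in> set vs"
        using c unfolding assms(3) folded_halved_cube_verts_def by (simp add: halved_cube_verts_iff)
      then obtain l where l: "l < length vs" "antipodal_class a = antipodal_class (rep l)"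
        using rep(2) by (auto simp: in_set_conv_nth)
      have "a \<in> antipodal_class (rep l)" unfolding l(2)[symmetric] by (simp add: antipodal_class_def)
      then have "c \<in> {r l, {..<2 * m} - r l}" unfolding cls[OF l(1)] using a(2) by blast
      with l(1) show "c \<in> (\<Union>l<length vs. {r l, {..<2 * m} - r l})" by blast
    qed
    show "disjoint_family_on (\<lambda>l. {r l, {..<2 * m} - r l}) {..<length vs}"
      unfolding disjoint_family_on_def
    proof (intro ballI impI)
      fix i j assume ij: "i \<in> {..<length vs}" "j \<in> {..<length vs}" "i \<noteq> j"
      then have lt: "i < length vs" "j < length vs" by simp_all
      show "{r i, {..<2 * m} - r i} \<inter> {r j, {..<2 * m} - r j} = {}"
      proof (rule ccontr)
        assume "{r i, {..<2 * m} - r i} \<inter> {r j, {..<2 * m} - r j} \<noteq> {}"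
        then obtain a b where ab: "a \<in> antipodal_class (rep i)" "b \<in> antipodal_class (rep j)"
          "support a = support b"
          unfolding cls[OF lt(1)] cls[OF lt(2)] by fastforce
        then have "a = b" using len'[OF ab(1) lt(1)] len'[OF ab(2) lt(2)] by (intro support_inject) simp_all
        then have "vs ! i = vs ! j"
          using antipodal_class_eq[OF ab(1)] antipodal_class_eq[OF ab(2)] rep(2) lt by simp
        then show False using assms(2) lt ij(3) by (simp add: nth_eq_iff_index_eq)
      qed
    qed
    show "folded_halved_cube_adj (vs ! i) (vs ! j) \<longleftrightarrow> hdist (r i) (r j) \<in> {2, 2 * m - 2}"
      if "i < length vs" "j < length vs" for i j
      unfolding rep(2)[OF that(1)] rep(2)[OF that(2)] r_def
      using that len assms(1) by (intro folded_halved_cube_adj_iff) auto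
  qed (use assms(1) in simp)
  then show ?thesis by blast
qed

theorem theorem7p1:
  fixes m :: nat and vs :: "bool list set list"
  assumes "m \<ge> 2"
    and "distinct vs" and "set vs = folded_halved_cube_verts m"
  shows "(\<exists>W \<in> adjacency_algebra vs folded_halved_cube_adj. complex_Hadamard W) \<longleftrightarrow> even m"
proof -
  obtain r where "folded_enumeration m vs folded_halved_cube_adj r"
    using folded_enumeration_exists[OF assms] by blast
  then interpret folded_enumeration m vs folded_halved_cube_adj r .
  show ?thesis using ex_Hadamard even_if_Hadamard by blast
qed

end
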